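(* Let $\mathbb V = (\mathbb F(\mathbb V), \{{\bf z}_t\}_{t \in \mathbb T})$ be a positive space of dimension $r$. Then the following conditions are equivalent for any two global monomials $u,v\in \mathcal U^{\rm mono}(\mathbb V)$: (a) there exists a chart ${\bf z}_{t_0}$ of $\mathbb V$ such that $\mathsf P_u^{t_0}\subseteq \mathsf P_v^{t_0}$; (b) for any tropical point $\beta\in \mathbb V(\mathbb R^{\rm max})$, we have $\beta(u)\leq \beta(v)$; (c) for any chart ${\bf z}_{t}$ of $\mathbb V$, we have $\mathsf P_u^{t}\subseteq \mathsf P_v^{t}$; (d) $u=v$.
   Context: A semifield $(\mathbb P,\cdot,\oplus)$ is an abelian multiplicative group $(\mathbb P,\cdot)$ with an auxiliary addition $\oplus$ that is commutative, associative, and over which multiplication distributes. The tropical semifield is $\mathbb R^{\rm max}=(\mathbb R,+,\max\{-,-\})$ (its multiplication is $+$, its addition is $\max$). A semifield homomorphism is a map preserving multiplication and addition. For free generators ${\bf z}=(z_1,\ldots,z_r)$ of a rational function field over $\mathbb Q$, $\mathbb Q_{\rm sf}({\bf z})=\{F/H \mid 0\neq F,H\in\mathbb Z_{\geq 0}[z_1,\ldots,z_r]\}$, a semifield under the usual multiplication and addition. A positive space of dimension $r$ is a pair $\mathbb V=(\mathbb F,\{{\bf z}_t\}_{t\in\mathbb T})$, where $\mathbb F=\mathbb F(\mathbb V)$ is the field of rational functions in $r$ variables over $\mathbb Q$, $\mathbb T$ is a non-empty index set, and each ${\bf z}_t=(z_{1;t},\ldots,z_{r;t})$ is an ordered set of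 free generators of $\mathbb F$ over $\mathbb Q$, such that $\mathbb Q_{\rm sf}({\bf z}_t)=\mathbb Q_{\rm sf}({\bf z}_{t'})\subseteq\mathbb F$ for all $t,t'\in\mathbb T$. Each ${\bf z}_t$ is called a chart. The ambient semifield is $\mathbb F_{>0}(\mathbb V)=\mathbb Q_{\rm sf}({\bf z}_t)$ (for any $t$). A tropical point is a semifield homomorphism $\beta:\mathbb F_{>0}(\mathbb V)\to\mathbb R^{\rm max}$; the set of them is $\mathbb V(\mathbb R^{\rm max})$. The coordinate algebra is $\mathcal U(\mathbb V)=\bigcap_{t\in\mathbb T}\mathbb Z[z_{1;t}^{\pm1},\ldots,z_{r;t}^{\pm1}]$; its elements are called global functions. A global monomial on $\mathbb V$ is an element of $\mathcal U(\mathbb V)$ of the form ${\bf z}_t^{\bf h}=z_{1;t}^{h_1}\cdots z_{r;t}^{h_r}$ for some $t\in\mathbb T$ and ${\bf h}\in\mathbb Z^r$. The set of global monomials is $\mathcal U^{\rm mono}(\mathbb V)=\bigcup_{t\in\mathbb T}\{{\bf z}_t^{\bf h}\mid {\bf h}\in\mathbb Z^r,\ {\bf z}_t^{\bf h}\in\mathcal U(\mathbb V)\}$, which is a subset of $\mathcal U(\mathbb V)\cap\mathbb F_{>0}(\mathbb V)$. The Newton polytope of a non-zero Laurent polynomial $\sum_{\bf h}c_{\bf h}{\bf z}^{\bf h}$ is the convex hull in $\mathbb R^r$ of $\{{\bf h}\in\mathbb Z^r\mid c_{\bf h}\neq0\}$. For non-zero $u\in\mathcal U(\mathbb V)$ and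 $t\in\mathbb T$, $\mathsf P_u^t\subseteq\mathbb R^r$ is the Newton polytope of $u$ expressed as a Laurent polynomial in $\mathbb Z[z_{1;t}^{\pm1},\ldots,z_{r;t}^{\pm1}]$. *)

theory Defs
  imports "HOL-Analysis.Analysis" "HOL-Library.Poly_Mapping"
begin

(* A polynomial (resp. Laurent polynomial) in r = CARD('n) variables is a finitely supported
   coefficient function on exponent vectors, of type (nat ^ 'n) \<Rightarrow>\<^sub>0 'c
   (resp. (int ^ 'n) \<Rightarrow>\<^sub>0 'c).  The field F is the type 'f itself, with its unique
   embedding of the rationals.  An ordered tuple of r elements of F is a vector 'f ^ 'n. *)

definition poly_eval ::
  "('c::zero \<Rightarrow> 'f::field) \<Rightarrow> 'f ^ 'n \<Rightarrow> ((nat ^ 'n) \<Rightarrow>\<^sub>0 'c) \<Rightarrow> 'f" where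
  "poly_eval \<iota> z p =
     (\<Sum>m\<in>Poly_Mapping.keys p. \<iota> (Poly_Mapping.lookup p m) * (\<Prod>i\<in>UNIV. (z $ i) ^ (m $ i)))"

definition laurent_monomial :: "'f::field ^ 'n \<Rightarrow> int ^ 'n \<Rightarrow> 'f" where
  "laurent_monomial z h = (\<Prod>i\<in>UNIV. (z $ i) powi (h $ i))"

definition laurent_eval :: "'f::field ^ 'n \<Rightarrow> ((int ^ 'n) \<Rightarrow>\<^sub>0 int) \<Rightarrow> 'f" where
  "laurent_eval z p =
     (\<Sum>h\<in>Poly_Mapping.keys p. of_int (Poly_Mapping.lookup p h) * laurent_monomial z h)"

(* The components of z are algebraically independent over the rationals and generate F as a
   field; in particular F is then a field of rational functions in r variables. *)
definition free_generators :: "'f::field_char_0 ^ 'n \<Rightarrow> bool" where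
  "free_generators z \<longleftrightarrow>
     (\<forall>p. poly_eval of_rat z p = 0 \<longrightarrow> p = 0) \<and>
     (\<forall>f. \<exists>p q. poly_eval of_rat z q \<noteq> 0 \<and> f = poly_eval of_rat z p / poly_eval of_rat z q)"

definition Q_sf :: "'f::field_char_0 ^ 'n \<Rightarrow> 'f set" where
  "Q_sf z = {poly_eval of_nat z F / poly_eval of_nat z H | F H. F \<noteq> 0 \<and> H \<noteq> 0}"

definition positive_space :: "'t set \<Rightarrow> ('t \<Rightarrow> 'f::field_char_0 ^ 'n) \<Rightarrow> bool" where
  "positive_space T z \<longleftrightarrow>
     T \<noteq> {} \<and> (\<forall>t\<in>T. free_generators (z t)) \<and> (\<forall>t\<in>T. \<forall>t'\<in>T. Q_sf (z t) = Q_sf (z t'))"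

(* In a positive space the choice of the chart is immaterial. *)
definition ambient_semifield :: "'t set \<Rightarrow> ('t \<Rightarrow> 'f::field_char_0 ^ 'n) \<Rightarrow> 'f set" where
  "ambient_semifield T z = Q_sf (z (SOME t. t \<in> T))"

(* Semifield homomorphisms to the reals with multiplication + and addition max; as functions
   on the ambient semifield they are normalised to be undefined outside of it. *)
definition tropical_points :: "'t set \<Rightarrow> ('t \<Rightarrow> 'f::field_char_0 ^ 'n) \<Rightarrow> ('f \<Rightarrow> real) set" where
  "tropical_points T z =
     {\<beta> \<in> extensional (ambient_semifield T z).
        \<forall>x\<in>ambient_semifield T z. \<forall>y\<in>ambient_semifield T z.
          \<beta> (x * y) = \<beta> x + \<beta> y \<and> \<beta> (x + y) = max (\<beta> x) (\<beta> y)}"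

definition coordinate_algebra :: "'t set \<Rightarrow> ('t \<Rightarrow> 'f::field_char_0 ^ 'n) \<Rightarrow> 'f set" where
  "coordinate_algebra T z = (\<Inter>t\<in>T. range (laurent_eval (z t)))"

definition global_monomials :: "'t set \<Rightarrow> ('t \<Rightarrow> 'f::field_char_0 ^ 'n) \<Rightarrow> 'f set" where
  "global_monomials T z =
     (\<Union>t\<in>T. {laurent_monomial (z t) h | h. laurent_monomial (z t) h \<in> coordinate_algebra T z})"

definition newton_polytope :: "((int ^ 'n) \<Rightarrow>\<^sub>0 int) \<Rightarrow> (real ^ 'n) set" where
  "newton_polytope p = convex hull ((\<lambda>h. \<chi> i. real_of_int (h $ i)) ` Poly_Mapping.keys p)"

(* The Newton polytope of u in the chart z; the Laurent expansion is unique because the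
   components of a chart are algebraically independent, and exists when u is a global function. *)
definition chart_polytope :: "'f::field_char_0 ^ 'n \<Rightarrow> 'f \<Rightarrow> (real ^ 'n) set" where
  "chart_polytope z u = newton_polytope (THE p. laurent_eval z p = u)"

end

theory Submission
  imports Defs
begin

text \<open>In a fixed chart, a tropical point \<open>\<beta>\<close> with \<open>w = (\<beta> z\<^sub>i)\<^sub>i\<close> evaluates a global function
  in the ambient semifield to the support function of its Newton polytope in direction \<open>w\<close>, and
  every \<open>w\<close> arises from a tropical point. Cancellation is the only difficulty: a Laurent polynomial
  may be subtraction-free as an element of the field while having negative coefficients. It is
  settled by the multiplicativity of leading forms. Hence an inclusion of polytopes in one chart
  gives \<open>\<beta> u \<le> \<beta> v\<close> for all \<open>\<beta>\<close>. Conversely, in a chart in which \<open>v\<close> is a monomial, these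
  inequalities leave a single exponent for \<open>u\<close>, so \<open>u = c v\<close> with an integer \<open>c\<close>. A chart in
  which \<open>u\<close> is a monomial shows \<open>c = 1\<close> or \<open>c = -1\<close>, and positivity excludes \<open>-1\<close>.\<close>

section \<open>Evaluation of Laurent polynomials\<close>

lemma laurent_eval_superset:
  assumes "finite S" "Poly_Mapping.keys p \<subseteq> S"
  shows "laurent_eval z p =
    (\<Sum>h\<in>S. of_int (Poly_Mapping.lookup p h) * laurent_monomial z h)"
  unfolding laurent_eval_def using assms
  by (intro sum.mono_neutral_left) (auto simp: in_keys_iff)

lemma laurent_eval_0 [simp]: "laurent_eval z 0 = 0"
  by (simp add: laurent_eval_def)

lemma laurent_eval_add: "laurent_eval z (p + q) = laurent_eval z p + laurent_eval z q"
proof -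
  let ?S = "Poly_Mapping.keys p \<union> Poly_Mapping.keys q"
  have "laurent_eval z (p + q) =
      (\<Sum>h\<in>?S. of_int (Poly_Mapping.lookup (p + q) h) * laurent_monomial z h)"
    by (rule laurent_eval_superset) (auto dest: subsetD[OF keys_add])
  also have "\<dots> = (\<Sum>h\<in>?S. of_int (Poly_Mapping.lookup p h) * laurent_monomial z h)
      + (\<Sum>h\<in>?S. of_int (Poly_Mapping.lookup q h) * laurent_monomial z h)"
    by (simp add: lookup_add algebra_simps sum.distrib)
  also have "\<dots> = laurent_eval z p + laurent_eval z q"
    by (simp add: laurent_eval_superset[of ?S])
  finally show ?thesis .
qed

lemma laurent_eval_uminus: "laurent_eval z (- p) = - laurent_eval z p"
  using laurent_eval_add[of z p "- p"] by (simp add: add_eq_0_iff)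

lemma laurent_eval_diff: "laurent_eval z (p - q) = laurent_eval z p - laurent_eval z q"
  using laurent_eval_add[of z p "- q"] by (simp add: laurent_eval_uminus)

lemma laurent_eval_sum: "laurent_eval z (sum f A) = (\<Sum>a\<in>A. laurent_eval z (f a))"
  by (induction A rule: infinite_finite_induct) (simp_all add: laurent_eval_add)

lemma laurent_eval_single [simp]:
  "laurent_eval z (Poly_Mapping.single h c) = of_int c * laurent_monomial z h"
  by (simp add: laurent_eval_def)

lemma laurent_monomial_0 [simp]: "laurent_monomial z 0 = 1"
  by (simp add: laurent_monomial_def)

lemma laurent_eval_1 [simp]: "laurent_eval z 1 = 1"
  by (simp add: laurent_eval_def)

lemma poly_mapping_eq_sum_single:
  "p = (\<Sum>h\<in>Poly_Mapping.keys p. Poly_Mapping.single h (Poly_Mapping.lookup p h))"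
  by (rule poly_mapping_eqI)
    (auto simp: lookup_sum lookup_single when_def in_keys_iff sum.delta')

text \<open>Makes the convolution product accessible to additive maps: evaluation and coefficient
  extraction can be pushed through the double sum.\<close>

lemma mult_eq_sum_single:
  "p * q = (\<Sum>h\<in>Poly_Mapping.keys p. \<Sum>k\<in>Poly_Mapping.keys q.
    Poly_Mapping.single (h + k) (Poly_Mapping.lookup p h * Poly_Mapping.lookup q k))"
  by (subst (1) poly_mapping_eq_sum_single[of p], subst (1) poly_mapping_eq_sum_single[of q])
    (simp add: sum_product mult_single)

text \<open>Nonvanishing coordinates matter: at 0 the exponents 1 and -1 give 1 on the left and 0 on
  the right.\<close>

lemma laurent_monomial_add:
  assumes "\<And>i. z $ i \<noteq> 0"
  shows "laurent_monomial z (h + k) = laurent_monomial z h * laurent_monomial z k"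
  using assms by (simp add: laurent_monomial_def power_int_add prod.distrib)

lemma laurent_monomial_nonzero:
  assumes "\<And>i. z $ i \<noteq> 0"
  shows "laurent_monomial z h \<noteq> 0"
  using assms by (simp add: laurent_monomial_def)

lemma laurent_eval_mult:
  assumes "\<And>i. z $ i \<noteq> 0"
  shows "laurent_eval z (p * q) = laurent_eval z p * laurent_eval z q"
proof -
  have "laurent_eval z (p * q) = (\<Sum>h\<in>Poly_Mapping.keys p. \<Sum>k\<in>Poly_Mapping.keys q.
      of_int (Poly_Mapping.lookup p h * Poly_Mapping.lookup q k) * laurent_monomial z (h + k))"
    by (simp add: mult_eq_sum_single laurent_eval_sum)
  also have "\<dots> = laurent_eval z p * laurent_eval z q"
    unfolding laurent_eval_def sum_product
    by (simp add: laurent_monomial_add[OF assms] mult_ac)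
  finally show ?thesis .
qed

section \<open>Clearing denominators\<close>

text \<open>Bridge between ordinary polynomials, in which free generation and \<open>Q_sf\<close>
  are stated, and Laurent polynomials, in which the argument is carried out.\<close>

definition int_vec :: "nat ^ 'n \<Rightarrow> int ^ 'n" where
  "int_vec m = (\<chi> i. int (m $ i))"

lemma inj_int_vec: "inj int_vec"
  by (auto simp: inj_def int_vec_def vec_eq_iff)

lemma laurent_monomial_int_vec: "laurent_monomial z (int_vec m) = (\<Prod>i\<in>UNIV. (z $ i) ^ (m $ i))"
  by (simp add: laurent_monomial_def int_vec_def)

lemma range_int_vec:
  assumes "\<And>i. 0 \<le> h $ i"
  shows "h \<in> range int_vec"
proof
  show "h = int_vec (\<chi> i. nat (h $ i))"
    using assms by (simp add: int_vec_def vec_eq_iff)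
qed simp

text \<open>Serves two changes of coefficients: \<open>rat_of_int\<close> for algebraic independence
  and \<open>nat\<close> for subtraction-free polynomials. The conditions concern only coefficients
  that occur, since \<open>nat\<close> is faithful only on nonnegative ones; \<open>\<iota>\<close>
  must not kill any of them, so that the support is preserved.\<close>

lemma poly_eval_map_key_int_vec:
  assumes keys: "Poly_Mapping.keys p \<subseteq> range int_vec"
    and j: "\<And>h. h \<in> Poly_Mapping.keys p \<Longrightarrow>
      j (\<iota> (Poly_Mapping.lookup p h)) = of_int (Poly_Mapping.lookup p h) \<and> \<iota> (Poly_Mapping.lookup p h) \<noteq> 0"
  shows "poly_eval j z (Poly_Mapping.map \<iota> (Poly_Mapping.map_key int_vec p)) = laurent_eval z p"
proof -
  let ?P = "Poly_Mapping.map \<iota> (Poly_Mapping.map_key int_vec p)"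
  have lookup: "Poly_Mapping.lookup ?P m =
      (\<iota> (Poly_Mapping.lookup p (int_vec m)) when int_vec m \<in> Poly_Mapping.keys p)" for m
    by (simp add: map.rep_eq map_key.rep_eq[OF inj_int_vec] in_keys_iff)
  have "Poly_Mapping.keys ?P = int_vec -` Poly_Mapping.keys p"
    using j by (auto simp: in_keys_iff[of _ ?P] lookup when_def split: if_splits)
  then have "poly_eval j z ?P = (\<Sum>m\<in>int_vec -` Poly_Mapping.keys p.
      of_int (Poly_Mapping.lookup p (int_vec m)) * laurent_monomial z (int_vec m))"
    unfolding poly_eval_def
    by (intro sum.cong) (auto simp: lookup laurent_monomial_int_vec j)
  also have "\<dots> = laurent_eval z p"
    unfolding laurent_eval_def
    by (rule sum.reindex_bij_betw)
      (use keys in \<open>auto simp: bij_betw_def intro: inj_on_subset[OF inj_int_vec]\<close>)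
  finally show ?thesis .
qed

text \<open>Multiplication by a single monomial clears all negative exponents of a finite
  support.\<close>

lemma shift_keys_int_vec:
  fixes S :: "(int ^ 'n::finite) set"
  assumes "finite S"
  shows "\<exists>k. \<forall>h\<in>S. k + h \<in> range int_vec"
  using assms
proof (induction rule: finite_induct)
  case (insert h S)
  then obtain k where k: "\<forall>h\<in>S. k + h \<in> range int_vec" by blast
  \<comment> \<open>Enlarging \<open>k\<close> keeps the earlier exponents nonnegative, and the
    bound \<open>- (h $ i)\<close> takes care of the new one.\<close>
  let ?k = "\<chi> i. max (k $ i) (- (h $ i))"
  have "?k + g \<in> range int_vec" if "g \<in> insert h S" for g
  proof (rule range_int_vec)
    fix i
    show "0 \<le> (?k + g) $ i"
    proof (cases "g = h")
      case False
      with that k obtain m where "k + g = int_vec m" by blast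
      then have "(k + g) $ i \<ge> 0" by (simp add: int_vec_def)
      then show ?thesis by simp
    qed simp
  qed
  then show ?case by blast
qed simp

lemma keys_single_mult:
  fixes p :: "(int ^ 'n::finite) \<Rightarrow>\<^sub>0 int"
  shows "Poly_Mapping.keys (Poly_Mapping.single k 1 * p) \<subseteq> (+) k ` Poly_Mapping.keys p"
  using keys_mult[of "Poly_Mapping.single k 1" p] by auto

section \<open>Consequences of algebraic independence\<close>

lemma free_generators_nonzero:
  fixes z :: "'f::field_char_0 ^ 'n::finite"
  assumes "free_generators z"
  shows "z $ i \<noteq> 0"
proof
  assume z: "z $ i = 0"
  \<comment> \<open>The variable with index \<open>i\<close>, viewed as a polynomial; a vanishing
    coordinate would be a root of it.\<close>
  let ?p = "Poly_Mapping.single (axis i 1 :: nat ^ 'n) (1 :: rat)"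
  have "(z $ i) ^ (axis i 1 $ i) = 0" using z by simp
  then have "poly_eval of_rat z ?p = 0"
    by (auto simp: poly_eval_def intro!: prod_zero)
  then have "?p = 0" using assms by (auto simp: free_generators_def)
  then have "Poly_Mapping.lookup ?p (axis i 1) = 0" by (simp only: lookup_zero)
  then show False by simp
qed

text \<open>Algebraic independence speaks of rational polynomials with natural exponents. A relation
  between Laurent monomials becomes one of these after multiplication by a suitable
  monomial.\<close>

lemma laurent_eval_eq_0_iff:
  fixes z :: "'f::field_char_0 ^ 'n::finite"
  assumes z: "free_generators z"
  shows "laurent_eval z p = 0 \<longleftrightarrow> p = 0"
proof
  assume p: "laurent_eval z p = 0"
  obtain k where k: "\<forall>h\<in>Poly_Mapping.keys p. k + h \<in> range int_vec"
    using shift_keys_int_vec[of "Poly_Mapping.keys p"] by auto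
  let ?q = "Poly_Mapping.single k 1 * p"
  let ?Q = "Poly_Mapping.map rat_of_int (Poly_Mapping.map_key int_vec ?q)"
  have keys: "Poly_Mapping.keys ?q \<subseteq> range int_vec"
    using keys_single_mult[of k p] k by fastforce
  have "poly_eval of_rat z ?Q = laurent_eval z ?q"
    by (rule poly_eval_map_key_int_vec[OF keys]) (auto simp: in_keys_iff)
  also have "\<dots> = 0"
    by (simp add: laurent_eval_mult free_generators_nonzero[OF z] p)
  finally have "?Q = 0" using z by (auto simp: free_generators_def)
  then have "Poly_Mapping.map_key int_vec ?q = 0"
    by (auto simp: map_eq_zero_iff in_keys_iff) (metis keys_eq_empty all_not_in_conv in_keys_iff)
  then have "int_vec -` Poly_Mapping.keys ?q = {}"
    by (metis keys_map_key[OF inj_int_vec] keys_zero)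
  then have "Poly_Mapping.keys ?q = {}" using keys by blast
  then have "?q = 0" by simp
  \<comment> \<open>The shift is undone by the inverse monomial, a unit, so no cancellation law is
    presupposed.\<close>
  then have "Poly_Mapping.single (- k) 1 * ?q = 0" by simp
  then show "p = 0" by (simp add: mult.assoc[symmetric] mult_single)
qed simp

lemma laurent_eval_eq_iff:
  fixes z :: "'f::field_char_0 ^ 'n::finite"
  assumes "free_generators z"
  shows "laurent_eval z p = laurent_eval z q \<longleftrightarrow> p = q"
  using laurent_eval_eq_0_iff[OF assms, of "p - q"] by (simp add: laurent_eval_diff)

text \<open>Uniqueness of the expansion makes the \<open>THE\<close> in
  \<open>chart_polytope\<close> denote \<open>p\<close>.\<close>

lemma chart_polytope_laurent_eval:
  fixes z :: "'f::field_char_0 ^ 'n::finite"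
  assumes "free_generators z"
  shows "chart_polytope z (laurent_eval z p) = newton_polytope p"
  unfolding chart_polytope_def by (simp add: laurent_eval_eq_iff[OF assms])

text \<open>Evaluation embeds Laurent polynomials into a field, so the absence of zero divisors is
  inherited from there.\<close>

lemma laurent_mult_nonzero:
  fixes z :: "'f::field_char_0 ^ 'n::finite" and p q :: "(int ^ 'n) \<Rightarrow>\<^sub>0 int"
  assumes z: "free_generators z" and "p \<noteq> 0" "q \<noteq> 0"
  shows "p * q \<noteq> 0"
proof -
  have "laurent_eval z (p * q) \<noteq> 0"
    using assms by (simp add: laurent_eval_mult free_generators_nonzero laurent_eval_eq_0_iff)
  then show ?thesis by (simp add: laurent_eval_eq_0_iff[OF z])
qed

section \<open>Subtraction-free elements\<close>

text \<open>Numerators and denominators of elements of the semifield, with monomial factors of any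
  sign of exponent allowed.\<close>

definition positive_laurent :: "((int ^ 'n) \<Rightarrow>\<^sub>0 int) \<Rightarrow> bool" where
  "positive_laurent p \<longleftrightarrow> p \<noteq> 0 \<and> (\<forall>h. 0 \<le> Poly_Mapping.lookup p h)"

lemma positive_laurent_single:
  "0 < c \<Longrightarrow> positive_laurent (Poly_Mapping.single h c)"
  unfolding positive_laurent_def
  by (auto simp: lookup_single when_def simp flip: keys_eq_empty)

lemma positive_laurent_1: "positive_laurent (1 :: (int ^ 'n::finite) \<Rightarrow>\<^sub>0 int)"
  using positive_laurent_single[of 1 "0 :: int ^ 'n"] by simp

text \<open>Nonnegative coefficients cannot cancel. This is why the maximal weight of a sum is a
  maximum in \<open>max_weight_add\<close>.\<close>

lemma keys_add_positive_laurent: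
  assumes "positive_laurent p" "positive_laurent q"
  shows "Poly_Mapping.keys (p + q) = Poly_Mapping.keys p \<union> Poly_Mapping.keys q"
  using assms by (auto simp: positive_laurent_def in_keys_iff lookup_add add_nonneg_eq_0_iff)

lemma positive_laurent_add:
  assumes "positive_laurent p" "positive_laurent q"
  shows "positive_laurent (p + q)"
  using assms keys_add_positive_laurent[OF assms]
  by (auto simp: positive_laurent_def lookup_add simp flip: keys_eq_empty)

text \<open>Coefficients of the product are sums of products of nonnegative integers; the chart
  supplies, through \<open>laurent_mult_nonzero\<close>, that the product does not vanish.\<close>

lemma positive_laurent_mult:
  fixes z :: "'f::field_char_0 ^ 'n::finite" and p q :: "(int ^ 'n) \<Rightarrow>\<^sub>0 int"
  assumes z: "free_generators z" and p: "positive_laurent p" and q: "positive_laurent q"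
  shows "positive_laurent (p * q)"
proof -
  have "0 \<le> Poly_Mapping.lookup (p * q) h" for h
    using p q by (auto simp: mult_eq_sum_single lookup_sum lookup_single when_def positive_laurent_def
        intro!: sum_nonneg)
  then show ?thesis
    using p q laurent_mult_nonzero[OF z] by (auto simp: positive_laurent_def)
qed

lemma poly_eval_of_nat_eq_laurent_eval:
  fixes F :: "(nat ^ 'n::finite) \<Rightarrow>\<^sub>0 nat" and z :: "'f::field_char_0 ^ 'n"
  assumes "F \<noteq> 0"
  shows "\<exists>p. positive_laurent p \<and> poly_eval of_nat z F = laurent_eval z p"
proof -
  let ?p = "\<Sum>m\<in>Poly_Mapping.keys F.
    Poly_Mapping.single (int_vec m) (int (Poly_Mapping.lookup F m))"
  \<comment> \<open>Injectivity of \<open>int_vec\<close> keeps the terms apart, so a nonzero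
    coefficient of \<open>F\<close> survives.\<close>
  have "Poly_Mapping.lookup ?p (int_vec m) = int (Poly_Mapping.lookup F m)" for m
    by (auto simp: lookup_sum lookup_single when_def inj_eq[OF inj_int_vec] in_keys_iff)
  moreover have "\<exists>m. Poly_Mapping.lookup F m \<noteq> 0"
    using assms by (metis keys_eq_empty all_not_in_conv in_keys_iff poly_mapping_eqI lookup_zero)
  ultimately have "?p \<noteq> 0" by (metis lookup_zero of_nat_eq_0_iff)
  moreover have "0 \<le> Poly_Mapping.lookup ?p h" for h
    by (auto simp: lookup_sum lookup_single when_def intro!: sum_nonneg)
  moreover have "poly_eval of_nat z F = laurent_eval z ?p"
    by (simp add: poly_eval_def laurent_eval_sum laurent_monomial_int_vec)
  ultimately show ?thesis unfolding positive_laurent_def by blast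
qed

lemma laurent_eval_eq_poly_eval_of_nat:
  fixes p :: "(int ^ 'n::finite) \<Rightarrow>\<^sub>0 int" and z :: "'f::field_char_0 ^ 'n"
  assumes p: "positive_laurent p" and keys: "Poly_Mapping.keys p \<subseteq> range int_vec"
  shows "\<exists>F. F \<noteq> 0 \<and> laurent_eval z p = poly_eval of_nat z F"
proof -
  let ?F = "Poly_Mapping.map nat (Poly_Mapping.map_key int_vec p)"
  have pos: "0 < Poly_Mapping.lookup p h" if "h \<in> Poly_Mapping.keys p" for h
    using p that by (metis in_keys_iff order_le_neq_trans positive_laurent_def)
  have "poly_eval of_nat z ?F = laurent_eval z p"
    by (rule poly_eval_map_key_int_vec[OF keys]) (auto dest: pos)
  moreover obtain h where "h \<in> Poly_Mapping.keys p"
    using p by (auto simp: positive_laurent_def simp flip: keys_eq_empty)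
  then obtain m where m: "int_vec m \<in> Poly_Mapping.keys p" using keys by blast
  then have "Poly_Mapping.lookup ?F m \<noteq> 0"
    using pos[OF m] by (simp add: map.rep_eq map_key.rep_eq[OF inj_int_vec])
  then have "?F \<noteq> 0" by force
  ultimately show ?thesis by metis
qed

text \<open>Passing to Laurent polynomials adds nothing new: one monomial clears the negative
  exponents of numerator and denominator together and leaves the quotient unchanged.\<close>

lemma Q_sf_iff:
  fixes z :: "'f::field_char_0 ^ 'n::finite"
  assumes z: "free_generators z"
  shows "x \<in> Q_sf z \<longleftrightarrow>
    (\<exists>p q. positive_laurent p \<and> positive_laurent q \<and> x = laurent_eval z p / laurent_eval z q)"
proof
  assume "x \<in> Q_sf z"
  then show "\<exists>p q. positive_laurent p \<and> positive_laurent q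
      \<and> x = laurent_eval z p / laurent_eval z q"
    unfolding Q_sf_def mem_Collect_eq using poly_eval_of_nat_eq_laurent_eval[of _ z] by metis
next
  assume "\<exists>p q. positive_laurent p \<and> positive_laurent q
      \<and> x = laurent_eval z p / laurent_eval z q"
  then obtain p q where pq: "positive_laurent p" "positive_laurent q"
    and x: "x = laurent_eval z p / laurent_eval z q" by blast
  obtain k where k: "\<forall>h\<in>Poly_Mapping.keys p \<union> Poly_Mapping.keys q. k + h \<in> range int_vec"
    using shift_keys_int_vec[of "Poly_Mapping.keys p \<union> Poly_Mapping.keys q"] by auto
  let ?s = "Poly_Mapping.single k (1::int)"
  have "x = laurent_eval z (?s * p) / laurent_eval z (?s * q)"
    by (simp add: x laurent_eval_mult free_generators_nonzero[OF z] laurent_monomial_nonzero)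
  moreover have "Poly_Mapping.keys (?s * p) \<subseteq> range int_vec"
    "Poly_Mapping.keys (?s * q) \<subseteq> range int_vec"
    using keys_single_mult[of k p] keys_single_mult[of k q] k by fastforce+
  moreover have "positive_laurent (?s * p)" "positive_laurent (?s * q)"
    using pq by (auto intro!: positive_laurent_mult[OF z] positive_laurent_single)
  ultimately show "x \<in> Q_sf z"
    unfolding Q_sf_def mem_Collect_eq using laurent_eval_eq_poly_eval_of_nat[of _ z] by metis
qed

lemma laurent_eval_in_Q_sf:
  fixes z :: "'f::field_char_0 ^ 'n::finite"
  assumes "free_generators z" "positive_laurent p"
  shows "laurent_eval z p \<in> Q_sf z"
  unfolding Q_sf_iff[OF assms(1)]
  using assms(2) positive_laurent_1 by (intro exI[of _ p] exI[of _ 1]) simp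

lemma laurent_monomial_in_Q_sf:
  fixes z :: "'f::field_char_0 ^ 'n::finite"
  assumes "free_generators z"
  shows "laurent_monomial z h \<in> Q_sf z"
  using laurent_eval_in_Q_sf[OF assms positive_laurent_single[of 1 h]] by simp

lemma positive_laurent_eval_nonzero:
  fixes z :: "'f::field_char_0 ^ 'n::finite"
  assumes "free_generators z" "positive_laurent p"
  shows "laurent_eval z p \<noteq> 0"
  using assms by (simp add: laurent_eval_eq_0_iff positive_laurent_def)

text \<open>The positivity that finally excludes \<open>u = - v\<close>: a sum of two elements of
  the semifield lies in it again and cannot vanish.\<close>

lemma Q_sf_nonzero:
  fixes z :: "'f::field_char_0 ^ 'n::finite"
  assumes "free_generators z" "x \<in> Q_sf z"
  shows "x \<noteq> 0"
  using assms by (auto simp: Q_sf_iff positive_laurent_eval_nonzero)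

lemma Q_sf_mult:
  fixes z :: "'f::field_char_0 ^ 'n::finite"
  assumes z: "free_generators z" and "x \<in> Q_sf z" "y \<in> Q_sf z"
  shows "x * y \<in> Q_sf z"
proof -
  obtain p q p' q' where pq: "positive_laurent p" "positive_laurent q"
      "positive_laurent p'" "positive_laurent q'"
    and xy: "x = laurent_eval z p / laurent_eval z q" "y = laurent_eval z p' / laurent_eval z q'"
    using assms by (auto simp: Q_sf_iff)
  have "x * y = laurent_eval z (p * p') / laurent_eval z (q * q')"
    by (simp add: xy laurent_eval_mult free_generators_nonzero[OF z])
  then show ?thesis
    unfolding Q_sf_iff[OF z] using pq positive_laurent_mult[OF z] by blast
qed

lemma Q_sf_add:
  fixes z :: "'f::field_char_0 ^ 'n::finite"
  assumes z: "free_generators z" and "x \<in> Q_sf z" "y \<in> Q_sf z"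
  shows "x + y \<in> Q_sf z"
proof -
  obtain p q p' q' where pq: "positive_laurent p" "positive_laurent q"
      "positive_laurent p'" "positive_laurent q'"
    and xy: "x = laurent_eval z p / laurent_eval z q" "y = laurent_eval z p' / laurent_eval z q'"
    using assms by (auto simp: Q_sf_iff)
  have "x + y = laurent_eval z (p * q' + p' * q) / laurent_eval z (q * q')"
    using positive_laurent_eval_nonzero[OF z] pq
    by (simp add: xy laurent_eval_mult laurent_eval_add free_generators_nonzero[OF z] add_frac_eq)
  then show ?thesis
    unfolding Q_sf_iff[OF z] using pq
    by (intro exI[of _ "p * q' + p' * q"] exI[of _ "q * q'"])
      (simp add: positive_laurent_add positive_laurent_mult[OF z])
qed

section \<open>Weights and leading forms\<close>

text \<open>The pairing of \<open>w\<close> with an exponent vector; it will be the value at the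
  monomial of a tropical point with coordinates \<open>w\<close>.\<close>

definition weight :: "real ^ 'n \<Rightarrow> int ^ 'n \<Rightarrow> real" where
  "weight w h = (\<Sum>i\<in>UNIV. w $ i * real_of_int (h $ i))"

text \<open>For nonzero \<open>p\<close>, the support function of the Newton polytope in direction
  \<open>w\<close>. For \<open>p = 0\<close> the maximum is over the empty set and carries no
  meaning.\<close>

definition max_weight :: "real ^ 'n \<Rightarrow> ((int ^ 'n) \<Rightarrow>\<^sub>0 int) \<Rightarrow> real" where
  "max_weight w p = Max (weight w ` Poly_Mapping.keys p)"

lemma weight_add: "weight w (h + k) = weight w h + weight w k"
  by (simp add: weight_def distrib_left sum.distrib)

lemma weight_0 [simp]: "weight w 0 = 0"
  by (simp add: weight_def)

lemma weight_le_max_weight: "h \<in> Poly_Mapping.keys p \<Longrightarrow> weight w h \<le> max_weight w p"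
  by (simp add: max_weight_def)

lemma max_weight_attained:
  assumes "p \<noteq> 0"
  obtains h where "h \<in> Poly_Mapping.keys p" "weight w h = max_weight w p"
proof -
  have "max_weight w p \<in> weight w ` Poly_Mapping.keys p"
    unfolding max_weight_def using assms by (intro Max_in) auto
  then show ?thesis using that by auto
qed

lemma max_weight_eqI:
  assumes "h \<in> Poly_Mapping.keys p" "weight w h = c"
    and "\<And>h. h \<in> Poly_Mapping.keys p \<Longrightarrow> weight w h \<le> c"
  shows "max_weight w p = c"
  unfolding max_weight_def using assms by (intro Max_eqI) auto

lemma max_weight_single [simp]: "c \<noteq> 0 \<Longrightarrow> max_weight w (Poly_Mapping.single h c) = weight w h"
  by (simp add: max_weight_def)

lemma max_weight_1 [simp]: "max_weight w (1 :: (int ^ 'n::finite) \<Rightarrow>\<^sub>0 int) = 0"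
  by (simp add: max_weight_def)

text \<open>\<open>l\<close> collects the terms on the face of the Newton polytope in direction
  \<open>w\<close>; it is nonzero because the maximum is attained.\<close>

lemma leading_form:
  fixes p :: "(int ^ 'n::finite) \<Rightarrow>\<^sub>0 int"
  assumes "p \<noteq> 0"
  obtains l r where "p = l + r" "l \<noteq> 0"
    "\<And>h. h \<in> Poly_Mapping.keys l \<Longrightarrow> weight w h = max_weight w p"
    "\<And>h. h \<in> Poly_Mapping.keys r \<Longrightarrow> weight w h < max_weight w p"
proof -
  let ?T = "{h \<in> Poly_Mapping.keys p. weight w h = max_weight w p}"
  let ?l = "\<Sum>h\<in>?T. Poly_Mapping.single h (Poly_Mapping.lookup p h)"
  have l: "Poly_Mapping.lookup ?l h = (Poly_Mapping.lookup p h when weight w h = max_weight w p)" for h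
    by (auto simp: lookup_sum lookup_single when_def in_keys_iff)
  obtain g where g: "g \<in> Poly_Mapping.keys p" "weight w g = max_weight w p"
    using max_weight_attained[OF assms] .
  show ?thesis
  proof
    show "p = ?l + (p - ?l)" by simp
    have "Poly_Mapping.lookup ?l g \<noteq> 0" using g by (simp add: l) (simp add: in_keys_iff)
    then show "?l \<noteq> 0" by (metis lookup_zero)
    show "weight w h = max_weight w p" if "h \<in> Poly_Mapping.keys ?l" for h
      using that unfolding in_keys_iff[of h ?l] l by simp
    show "weight w h < max_weight w p" if "h \<in> Poly_Mapping.keys (p - ?l)" for h
    proof -
      have "h \<in> Poly_Mapping.keys p" "weight w h \<noteq> max_weight w p"
        using that unfolding in_keys_iff[of h "p - ?l"] lookup_minus l
        by (auto simp: in_keys_iff when_def split: if_splits)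
      then show ?thesis using weight_le_max_weight[of h p w] by simp
    qed
  qed
qed

text \<open>Coefficients of either sign are allowed. The product of the leading forms is nonzero and
  homogeneous of weight \<open>?c\<close>, and all remaining products have smaller weight, so they
  cannot cancel it.\<close>

lemma max_weight_mult:
  fixes z :: "'f::field_char_0 ^ 'n::finite" and p q :: "(int ^ 'n) \<Rightarrow>\<^sub>0 int"
  assumes z: "free_generators z" and "p \<noteq> 0" "q \<noteq> 0"
  shows "max_weight w (p * q) = max_weight w p + max_weight w q"
proof -
  let ?c = "max_weight w p + max_weight w q"
  obtain l r where p: "p = l + r" "l \<noteq> 0"
    and l: "\<And>h. h \<in> Poly_Mapping.keys l \<Longrightarrow> weight w h = max_weight w p"
    and r: "\<And>h. h \<in> Poly_Mapping.keys r \<Longrightarrow> weight w h < max_weight w p"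
    using leading_form[OF \<open>p \<noteq> 0\<close>] by metis
  obtain l' r' where q: "q = l' + r'" "l' \<noteq> 0"
    and l': "\<And>h. h \<in> Poly_Mapping.keys l' \<Longrightarrow> weight w h = max_weight w q"
    and r': "\<And>h. h \<in> Poly_Mapping.keys r' \<Longrightarrow> weight w h < max_weight w q"
    using leading_form[OF \<open>q \<noteq> 0\<close>] by metis
  obtain g where g: "g \<in> Poly_Mapping.keys (l * l')"
    using laurent_mult_nonzero[OF z p(2) q(2)] by (auto simp flip: keys_eq_empty)
  have g_weight: "weight w g = ?c"
    using subsetD[OF keys_mult g] l l' by (auto simp: weight_add)
  have "weight w h < ?c" if "h \<in> Poly_Mapping.keys (l * r' + r * q)" for h
  proof -
    have "h \<in> Poly_Mapping.keys (l * r') \<or> h \<in> Poly_Mapping.keys (r * q)"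
      using subsetD[OF keys_add that] by blast
    then show ?thesis
    proof
      assume "h \<in> Poly_Mapping.keys (l * r')"
      then obtain a b where "h = a + b" "a \<in> Poly_Mapping.keys l" "b \<in> Poly_Mapping.keys r'"
        using keys_mult by blast
      then show ?thesis using l[of a] r'[of b] by (simp add: weight_add)
    next
      assume "h \<in> Poly_Mapping.keys (r * q)"
      then obtain a b where "h = a + b" "a \<in> Poly_Mapping.keys r" "b \<in> Poly_Mapping.keys q"
        using keys_mult by blast
      then show ?thesis
        using r[of a] weight_le_max_weight[of b q w] by (simp add: weight_add)
    qed
  qed
  then have "g \<notin> Poly_Mapping.keys (l * r' + r * q)" using g_weight by force
  moreover have "p * q = l * l' + (l * r' + r * q)"
    unfolding p q by (simp add: algebra_simps)
  ultimately have "g \<in> Poly_Mapping.keys (p * q)"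
    using g by (simp add: in_keys_iff lookup_add)
  then show ?thesis
  proof (rule max_weight_eqI[OF _ g_weight])
    fix h assume "h \<in> Poly_Mapping.keys (p * q)"
    then obtain a b where "h = a + b" "a \<in> Poly_Mapping.keys p" "b \<in> Poly_Mapping.keys q"
      using keys_mult by blast
    then show "weight w h \<le> ?c"
      using weight_le_max_weight[of a p w] weight_le_max_weight[of b q w]
      by (simp add: weight_add)
  qed
qed

lemma max_weight_add:
  assumes "positive_laurent p" "positive_laurent q"
  shows "max_weight w (p + q) = max (max_weight w p) (max_weight w q)"
  using assms unfolding max_weight_def keys_add_positive_laurent[OF assms] image_Un
  by (intro Max_Un) (auto simp: positive_laurent_def)

text \<open>The weight extends to a linear functional, whose maximum over a convex hull is reached
  on the generating points: the polytope of \<open>q\<close> lies in the half-space bounded by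
  \<open>max_weight w q\<close>.\<close>

lemma max_weight_mono:
  fixes p q :: "(int ^ 'n::finite) \<Rightarrow>\<^sub>0 int"
  assumes "p \<noteq> 0" and sub: "newton_polytope p \<subseteq> newton_polytope q"
  shows "max_weight w p \<le> max_weight w q"
proof -
  let ?e = "\<lambda>h :: int ^ 'n. \<chi> i. real_of_int (h $ i)"
  have weight: "weight w h = w \<bullet> ?e h" for h
    by (simp add: weight_def inner_vec_def)
  obtain h where h: "h \<in> Poly_Mapping.keys p" "weight w h = max_weight w p"
    using max_weight_attained[OF assms(1)] .
  have "?e h \<in> newton_polytope q"
    using h(1) sub unfolding newton_polytope_def by (meson hull_inc image_eqI subsetD)
  also have "\<dots> \<subseteq> {x. w \<bullet> x \<le> max_weight w q}"
    unfolding newton_polytope_def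
    by (intro hull_minimal convex_halfspace_le)
      (use weight_le_max_weight[of _ q w] in \<open>auto simp: weight\<close>)
  finally show ?thesis using h(2) by (simp add: weight)
qed

section \<open>Tropical points\<close>

text \<open>Tropical points without the normalisation outside the semifield, so that a function may
  be built first and restricted afterwards.\<close>

definition tropical_hom :: "'f::field set \<Rightarrow> ('f \<Rightarrow> real) \<Rightarrow> bool" where
  "tropical_hom A \<beta> \<longleftrightarrow>
     (\<forall>x\<in>A. \<forall>y\<in>A. \<beta> (x * y) = \<beta> x + \<beta> y \<and> \<beta> (x + y) = max (\<beta> x) (\<beta> y))"

context
  fixes z :: "'f::field_char_0 ^ 'n::finite" and \<beta> :: "'f \<Rightarrow> real" and w :: "real ^ 'n"
  assumes z: "free_generators z" and \<beta>: "tropical_hom (Q_sf z) \<beta>"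
  defines "w \<equiv> \<chi> i. \<beta> (z $ i)"
begin

lemma tropical_hom_mult: "x \<in> Q_sf z \<Longrightarrow> y \<in> Q_sf z \<Longrightarrow> \<beta> (x * y) = \<beta> x + \<beta> y"
  and tropical_hom_add: "x \<in> Q_sf z \<Longrightarrow> y \<in> Q_sf z \<Longrightarrow> \<beta> (x + y) = max (\<beta> x) (\<beta> y)"
  using \<beta> by (auto simp: tropical_hom_def)

lemma one_in_Q_sf: "1 \<in> Q_sf z"
  using laurent_monomial_in_Q_sf[OF z, of 0] by simp

lemma tropical_hom_1: "\<beta> 1 = 0"
  using tropical_hom_mult[OF one_in_Q_sf one_in_Q_sf] by simp

text \<open>Tropical addition is idempotent, so positive integer coefficients are invisible. The
  count starts at 1 since 0 is not in the semifield.\<close>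

lemma tropical_hom_of_nat: "of_nat (Suc n) \<in> Q_sf z \<and> \<beta> (of_nat (Suc n)) = 0"
proof (induction n)
  case (Suc n)
  then show ?case
    using Q_sf_add[OF z one_in_Q_sf, of "of_nat (Suc n)"]
      tropical_hom_add[OF one_in_Q_sf, of "of_nat (Suc n)"] tropical_hom_1
    by simp
qed (simp add: one_in_Q_sf tropical_hom_1)

lemma tropical_hom_laurent_monomial_add:
  "\<beta> (laurent_monomial z (h + k)) = \<beta> (laurent_monomial z h) + \<beta> (laurent_monomial z k)"
  by (simp add: laurent_monomial_add[OF free_generators_nonzero[OF z]] tropical_hom_mult
      laurent_monomial_in_Q_sf[OF z])

lemma laurent_monomial_axis: "laurent_monomial z (axis i k) = (z $ i) powi k"
proof -
  have "laurent_monomial z (axis i k) = (\<Prod>j\<in>UNIV. if j = i then (z $ i) powi k else 1)"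
    unfolding laurent_monomial_def by (intro prod.cong) (auto simp: axis_def)
  then show ?thesis by simp
qed

lemma tropical_hom_axis_nat: "\<beta> (laurent_monomial z (axis i (int n))) = real n * \<beta> (z $ i)"
proof (induction n)
  case (Suc n)
  have "axis i (int (Suc n)) = (axis i 1 + axis i (int n) :: int ^ 'n)"
    by (simp add: vec_eq_iff axis_def)
  then show ?case
    using Suc by (simp add: tropical_hom_laurent_monomial_add laurent_monomial_axis[of i 1]
        algebra_simps)
qed (simp add: laurent_monomial_axis tropical_hom_1)

lemma tropical_hom_axis: "\<beta> (laurent_monomial z (axis i k)) = real_of_int k * \<beta> (z $ i)"
proof (cases "0 \<le> k")
  case True
  then show ?thesis using tropical_hom_axis_nat[of i "nat k"] by simp
next
  case False
  \<comment> \<open>Negative exponents reduce to positive ones, as inverse monomials have opposite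
    values.\<close>
  have "axis i k + axis i (- k) = (0 :: int ^ 'n)"
    by (simp add: vec_eq_iff axis_def)
  then have "\<beta> (laurent_monomial z (axis i k)) + \<beta> (laurent_monomial z (axis i (- k))) = 0"
    by (simp flip: tropical_hom_laurent_monomial_add add: tropical_hom_1)
  then show ?thesis using False tropical_hom_axis_nat[of i "nat (- k)"] by simp
qed

lemma tropical_hom_laurent_monomial: "\<beta> (laurent_monomial z h) = weight w h"
proof -
  have "\<beta> (laurent_monomial z (\<Sum>i\<in>I. axis i (h $ i))) = (\<Sum>i\<in>I. \<beta> (z $ i) * real_of_int (h $ i))"
    if "finite I" for I
    using that
    by (induction rule: finite_induct)
      (simp_all add: tropical_hom_1 tropical_hom_laurent_monomial_add tropical_hom_axis)
  from this[of UNIV] have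
    "\<beta> (laurent_monomial z (\<Sum>i\<in>UNIV. axis i (h $ i))) = weight w h"
    by (simp add: weight_def w_def)
  also have "(\<Sum>i\<in>UNIV. axis i (h $ i)) = h"
    by (simp add: vec_eq_iff axis_def)
  finally show ?thesis .
qed

text \<open>Each term lies in the semifield and takes the weight of its exponent as value; the sum
  of the terms turns into a maximum.\<close>

lemma tropical_hom_laurent_eval_positive:
  assumes p: "positive_laurent p"
  shows "\<beta> (laurent_eval z p) = max_weight w p"
proof -
  let ?m = "\<lambda>h. of_int (Poly_Mapping.lookup p h) * laurent_monomial z h"
  have monom: "?m h \<in> Q_sf z \<and> \<beta> (?m h) = weight w h" if "h \<in> Poly_Mapping.keys p" for h
  proof -
    have "0 < Poly_Mapping.lookup p h"
      using p that by (metis in_keys_iff order_le_neq_trans positive_laurent_def)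
    then obtain n where "Poly_Mapping.lookup p h = int (Suc n)"
      by (metis gr0_implies_Suc zero_less_imp_eq_int)
    then have m: "?m h = of_nat (Suc n) * laurent_monomial z h"
      by (metis of_int_of_nat_eq)
    show ?thesis
      unfolding m using tropical_hom_of_nat[of n] laurent_monomial_in_Q_sf[OF z, of h]
        Q_sf_mult[OF z] tropical_hom_mult tropical_hom_laurent_monomial by (metis add_0)
  qed
  \<comment> \<open>The induction starts from singletons: the empty sum is 0, which is outside the
    semifield.\<close>
  have "sum ?m S \<in> Q_sf z \<and> \<beta> (sum ?m S) = Max (weight w ` S)"
    if "finite S" "S \<noteq> {}" "S \<subseteq> Poly_Mapping.keys p" for S
    using that
  proof (induction rule: finite_ne_induct)
    case (singleton h)
    then show ?case using monom[of h] by simp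
  next
    case (insert h S)
    then show ?case using monom[of h] Q_sf_add[OF z] by (simp add: tropical_hom_add)
  qed
  from this[of "Poly_Mapping.keys p"] show ?thesis
    using p by (simp add: positive_laurent_def laurent_eval_def max_weight_def)
qed

text \<open>\<open>p\<close> may have negative coefficients. Writing its value as a quotient of
  subtraction-free \<open>F\<close> and \<open>H\<close> gives \<open>F = p * H\<close>, and
  multiplicativity of \<open>max_weight\<close> transfers the formula from \<open>F\<close> and
  \<open>H\<close> to \<open>p\<close>.\<close>

lemma tropical_hom_laurent_eval:
  assumes "laurent_eval z p \<in> Q_sf z"
  shows "\<beta> (laurent_eval z p) = max_weight w p"
proof -
  obtain F H where FH: "positive_laurent F" "positive_laurent H"
    and eq: "laurent_eval z p = laurent_eval z F / laurent_eval z H"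
    using assms unfolding Q_sf_iff[OF z] by blast
  have nz: "p \<noteq> 0" "H \<noteq> 0"
    using Q_sf_nonzero[OF z assms] FH by (auto simp: positive_laurent_def)
  have "laurent_eval z (p * H) = laurent_eval z F"
    using positive_laurent_eval_nonzero[OF z FH(2)]
    by (simp add: laurent_eval_mult free_generators_nonzero[OF z] eq)
  then have F: "F = p * H" by (simp add: laurent_eval_eq_iff[OF z])
  have "\<beta> (laurent_eval z p * laurent_eval z H) = \<beta> (laurent_eval z p) + \<beta> (laurent_eval z H)"
    by (rule tropical_hom_mult[OF assms laurent_eval_in_Q_sf[OF z FH(2)]])
  moreover have "laurent_eval z p * laurent_eval z H = laurent_eval z F"
    unfolding F by (simp add: laurent_eval_mult free_generators_nonzero[OF z])
  ultimately show ?thesis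
    using tropical_hom_laurent_eval_positive[OF FH(1)] tropical_hom_laurent_eval_positive[OF FH(2)]
      max_weight_mult[OF z nz, of w] unfolding F by simp
qed

end

text \<open>The difference of maximal weights of numerator and denominator defines a function on all
  nonzero fractions. It is multiplicative everywhere, but turns sums into maxima only where nothing
  cancels, as on \<open>Q_sf z\<close>.\<close>

lemma tropical_hom_exists:
  fixes z :: "'f::field_char_0 ^ 'n::finite" and w :: "real ^ 'n"
  assumes z: "free_generators z"
  obtains \<beta> where "tropical_hom (Q_sf z) \<beta>"
    "\<And>p. p \<noteq> 0 \<Longrightarrow> \<beta> (laurent_eval z p) = max_weight w p"
proof -
  define R where "R x c \<longleftrightarrow> (\<exists>p q. p \<noteq> 0 \<and> q \<noteq> 0 \<and>
    x = laurent_eval z p / laurent_eval z q \<and> c = max_weight w p - max_weight w q)" for x c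
  have nz: "laurent_eval z p \<noteq> 0" if "p \<noteq> 0" for p
    using that by (simp add: laurent_eval_eq_0_iff[OF z])
  have "c = d" if Rc: "R x c" and Rd: "R x d" for x c d
  proof -
    obtain p q where pq: "p \<noteq> 0" "q \<noteq> 0" "x = laurent_eval z p / laurent_eval z q"
        "c = max_weight w p - max_weight w q"
      using Rc unfolding R_def by blast
    obtain p' q' where pq': "p' \<noteq> 0" "q' \<noteq> 0" "x = laurent_eval z p' / laurent_eval z q'"
        "d = max_weight w p' - max_weight w q'"
      using Rd unfolding R_def by blast
    \<comment> \<open>Cross-multiplication and uniqueness of expansions give an identity of Laurent
      polynomials, to which \<open>max_weight_mult\<close> applies.\<close>
    have "laurent_eval z (p * q') = laurent_eval z (p' * q)"
      using pq pq' nz by (simp add: laurent_eval_mult free_generators_nonzero[OF z] field_simps)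
    then have "p * q' = p' * q" by (simp add: laurent_eval_eq_iff[OF z])
    then have "max_weight w p + max_weight w q' = max_weight w p' + max_weight w q"
      using pq pq' by (simp flip: max_weight_mult[OF z])
    then show "c = d" using pq pq' by simp
  qed
  then have the: "(THE c. R x c) = c" if "R x c" for x c
    using that by blast
  let ?\<beta> = "\<lambda>x. THE c. R x c"
  show thesis
  proof
    show "tropical_hom (Q_sf z) ?\<beta>"
      unfolding tropical_hom_def
    proof (intro ballI)
      fix x y assume xy: "x \<in> Q_sf z" "y \<in> Q_sf z"
      obtain p q p' q' where pq: "positive_laurent p" "positive_laurent q"
          "positive_laurent p'" "positive_laurent q'"
        and x: "x = laurent_eval z p / laurent_eval z q"
        and y: "y = laurent_eval z p' / laurent_eval z q'"
        using xy by (auto simp: Q_sf_iff[OF z])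
      have pq0: "p \<noteq> 0" "q \<noteq> 0" "p' \<noteq> 0" "q' \<noteq> 0"
        using pq by (auto simp: positive_laurent_def)
      note mult_pos = positive_laurent_mult[OF z] and mult_nz = laurent_mult_nonzero[OF z]
      have "R x (max_weight w p - max_weight w q)" "R y (max_weight w p' - max_weight w q')"
        unfolding R_def using x y pq0 by blast+
      moreover have "R (x * y) (max_weight w (p * p') - max_weight w (q * q'))"
        unfolding R_def using x y pq0 mult_nz
        by (intro exI[of _ "p * p'"] exI[of _ "q * q'"])
          (simp add: laurent_eval_mult free_generators_nonzero[OF z])
      \<comment> \<open>Over the common denominator the numerator is a sum of positive Laurent
        polynomials, so \<open>max_weight_add\<close> is available.\<close>
      moreover have "R (x + y) (max_weight w (p * q' + p' * q) - max_weight w (q * q'))"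
        unfolding R_def using x y pq0 mult_nz pq mult_pos nz
          positive_laurent_add[of "p * q'" "p' * q"]
        by (intro exI[of _ "p * q' + p' * q"] exI[of _ "q * q'"])
          (simp add: laurent_eval_mult laurent_eval_add free_generators_nonzero[OF z] field_simps
            positive_laurent_def)
      ultimately show "?\<beta> (x * y) = ?\<beta> x + ?\<beta> y \<and> ?\<beta> (x + y) = max (?\<beta> x) (?\<beta> y)"
        using pq0 pq mult_pos
        by (simp add: the max_weight_mult[OF z] max_weight_add)
    qed
    show "?\<beta> (laurent_eval z p) = max_weight w p" if "p \<noteq> 0" for p
    proof (rule the)
      show "R (laurent_eval z p) (max_weight w p)"
        unfolding R_def using that by (intro exI[of _ p] exI[of _ 1]) simp
    qed
  qed
qed

section \<open>Positive spaces\<close>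

context
  fixes T :: "'t set" and z :: "'t \<Rightarrow> 'f::field_char_0 ^ 'n::finite"
  assumes V: "positive_space T z"
begin

lemma positive_space_free_generators: "t \<in> T \<Longrightarrow> free_generators (z t)"
  using V by (simp add: positive_space_def)

lemma ambient_semifield_eq: "t \<in> T \<Longrightarrow> ambient_semifield T z = Q_sf (z t)"
  using V by (metis ambient_semifield_def positive_space_def some_in_eq)

lemma tropical_points_iff:
  "t \<in> T \<Longrightarrow> \<beta> \<in> tropical_points T z \<longleftrightarrow>
    \<beta> \<in> extensional (Q_sf (z t)) \<and> tropical_hom (Q_sf (z t)) \<beta>"
  by (auto simp: tropical_points_def tropical_hom_def ambient_semifield_eq)

text \<open>A monomial lies in the semifield of its own chart, and all charts share the same
  semifield.\<close>

lemma global_monomial_in_Q_sf: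
  assumes "u \<in> global_monomials T z" "t \<in> T"
  shows "u \<in> Q_sf (z t)"
proof -
  obtain s h where s: "s \<in> T" "u = laurent_monomial (z s) h"
    using assms(1) by (auto simp: global_monomials_def)
  then show ?thesis
    using laurent_monomial_in_Q_sf[OF positive_space_free_generators[OF s(1)], of h]
      ambient_semifield_eq[OF s(1)] ambient_semifield_eq[OF assms(2)] by simp
qed

lemma global_monomial_laurent:
  assumes "u \<in> global_monomials T z" "t \<in> T"
  obtains p where "u = laurent_eval (z t) p" "p \<noteq> 0"
proof -
  obtain p where p: "u = laurent_eval (z t) p"
    using assms by (auto simp: global_monomials_def coordinate_algebra_def)
  moreover have "u \<noteq> 0"
    using Q_sf_nonzero global_monomial_in_Q_sf[OF assms]
      positive_space_free_generators[OF assms(2)] by blast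
  ultimately show ?thesis using that by fastforce
qed

section \<open>From polytopes to tropical inequalities, and from these to equality\<close>

lemma tropical_le_of_chart_polytope_subset:
  assumes u: "u \<in> global_monomials T z" and v: "v \<in> global_monomials T z" and t: "t \<in> T"
    and sub: "chart_polytope (z t) u \<subseteq> chart_polytope (z t) v"
    and \<beta>: "\<beta> \<in> tropical_points T z"
  shows "\<beta> u \<le> \<beta> v"
proof -
  note zt = positive_space_free_generators[OF t]
  obtain p where p: "u = laurent_eval (z t) p" "p \<noteq> 0" using global_monomial_laurent[OF u t] .
  obtain q where q: "v = laurent_eval (z t) q" "q \<noteq> 0" using global_monomial_laurent[OF v t] .
  have hom: "tropical_hom (Q_sf (z t)) \<beta>" using \<beta> t by (simp add: tropical_points_iff)
  have "newton_polytope p \<subseteq> newton_polytope q"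
    using sub by (simp add: p q chart_polytope_laurent_eval[OF zt])
  \<comment> \<open>Both values are support functions in one direction, and these are monotone under
    inclusion.\<close>
  then show ?thesis
    using tropical_hom_laurent_eval[OF zt hom] global_monomial_in_Q_sf[OF u t]
      global_monomial_in_Q_sf[OF v t] max_weight_mono[OF p(2)]
    by (simp add: p q)
qed

text \<open>Two charts are played off: in \<open>t\<close>, where \<open>v\<close> is a monomial,
  the support of \<open>u\<close> collapses to one point; in \<open>s\<close>, where
  \<open>u\<close> is a monomial, the remaining integer factor is seen to be a unit.\<close>

lemma global_monomial_eq_of_tropical_le:
  assumes u: "u \<in> global_monomials T z" and v: "v \<in> global_monomials T z"
    and le: "\<And>\<beta>. \<beta> \<in> tropical_points T z \<Longrightarrow> \<beta> u \<le> \<beta> v"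
  shows "u = v"
proof -
  obtain t k where t: "t \<in> T" and v_monom: "v = laurent_monomial (z t) k"
    using v by (auto simp: global_monomials_def)
  obtain s h where s: "s \<in> T" and u_monom: "u = laurent_monomial (z s) h"
    using u by (auto simp: global_monomials_def)
  note zt = positive_space_free_generators[OF t] and zs = positive_space_free_generators[OF s]
  obtain p where p: "u = laurent_eval (z t) p" "p \<noteq> 0" using global_monomial_laurent[OF u t] .
  obtain q where q: "v = laurent_eval (z s) q" "q \<noteq> 0" using global_monomial_laurent[OF v s] .
  let ?k = "Poly_Mapping.single k (1::int)"
  have v_single: "v = laurent_eval (z t) ?k" by (simp add: v_monom)
  have weight_le: "weight w g \<le> weight w k" if g: "g \<in> Poly_Mapping.keys p" for w g
  proof -
    obtain \<beta> where \<beta>: "tropical_hom (Q_sf (z t)) \<beta>"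
      and eval: "\<And>p. p \<noteq> 0 \<Longrightarrow> \<beta> (laurent_eval (z t) p) = max_weight w p"
      using tropical_hom_exists[OF zt] by blast
    \<comment> \<open>Tropical points are extensional; since the semifield is closed under both
      operations, restriction preserves the homomorphism laws.\<close>
    let ?\<beta> = "restrict \<beta> (Q_sf (z t))"
    have "tropical_hom (Q_sf (z t)) ?\<beta>"
      using \<beta> Q_sf_mult[OF zt] Q_sf_add[OF zt] by (simp add: tropical_hom_def)
    then have "?\<beta> \<in> tropical_points T z" using t by (simp add: tropical_points_iff)
    then have "?\<beta> u \<le> ?\<beta> v" by (rule le)
    then have "\<beta> u \<le> \<beta> v" using global_monomial_in_Q_sf[OF _ t] u v by simp
    moreover have "\<beta> u = max_weight w p"
      using eval[OF p(2)] p(1) by simp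
    moreover have "?k \<noteq> 0" by (simp flip: keys_eq_empty)
    then have "\<beta> v = weight w k"
      using eval[of ?k] v_single by simp
    ultimately show ?thesis using weight_le_max_weight[OF g, of w] by simp
  qed
  have "Poly_Mapping.keys p \<subseteq> {k}"
  proof
    fix g assume g: "g \<in> Poly_Mapping.keys p"
    \<comment> \<open>Testing in the direction from \<open>k\<close> to \<open>g\<close> makes the
      difference of weights the squared length of \<open>g - k\<close>, which is then at most
      0.\<close>
    let ?w = "\<chi> i. real_of_int (g $ i - k $ i)"
    have "weight ?w g - weight ?w k = (\<Sum>i\<in>UNIV. (real_of_int (g $ i - k $ i))\<^sup>2)"
      by (simp add: weight_def power2_eq_square algebra_simps flip: sum_subtractf)
    then have "(\<Sum>i\<in>UNIV. (real_of_int (g $ i - k $ i))\<^sup>2) \<le> 0"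
      using weight_le[OF g, of ?w] by simp
    then have "(\<Sum>i\<in>UNIV. (real_of_int (g $ i - k $ i))\<^sup>2) = 0"
      by (intro antisym sum_nonneg) auto
    then have "g = k" by (simp add: sum_nonneg_eq_0_iff vec_eq_iff)
    then show "g \<in> {k}" by simp
  qed
  then have "u = of_int (Poly_Mapping.lookup p k) * v"
    using laurent_eval_superset[of "{k}" p "z t"] by (simp add: p v_monom)
  then obtain c :: int where c: "u = of_int c * v" by blast
  have "laurent_eval (z s) (Poly_Mapping.single h 1) = laurent_eval (z s) (of_int c * q)"
    using c by (simp add: laurent_eval_mult free_generators_nonzero[OF zs] u_monom q
        flip: single_of_int)
  then have "Poly_Mapping.single h 1 = of_int c * q" by (rule iffD1[OF laurent_eval_eq_iff[OF zs]])
  \<comment> \<open>Comparison of coefficients at \<open>h\<close> writes 1 as a product of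
    \<open>c\<close> with an integer, as \<open>v\<close> has integer coefficients in the chart
    \<open>s\<close>.\<close>
  then have "Poly_Mapping.lookup (Poly_Mapping.single h 1) h = c * Poly_Mapping.lookup q h"
    by (simp flip: single_of_int mult_map_scale_conv_mult add: map.rep_eq when_def)
  then have "c = 1 \<or> c = - 1" by (auto simp: zmult_eq_1_iff)
  \<comment> \<open>The case \<open>c = - 1\<close> would give a vanishing sum of two semifield
    elements.\<close>
  moreover have "u + v \<noteq> 0"
    using Q_sf_nonzero[OF zt Q_sf_add[OF zt]] global_monomial_in_Q_sf[OF _ t] u v by blast
  ultimately show ?thesis using c by auto
qed

end

theorem theorem1p4:
  fixes T :: "'t set" and z :: "'t \<Rightarrow> 'f::field_char_0 ^ 'n::finite" and u v :: 'f
  assumes "positive_space T z"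
    and "u \<in> global_monomials T z" and "v \<in> global_monomials T z"
  shows "((\<exists>t\<^sub>0\<in>T. chart_polytope (z t\<^sub>0) u \<subseteq> chart_polytope (z t\<^sub>0) v)
            \<longleftrightarrow> (\<forall>\<beta>\<in>tropical_points T z. \<beta> u \<le> \<beta> v))
       \<and> ((\<forall>\<beta>\<in>tropical_points T z. \<beta> u \<le> \<beta> v)
            \<longleftrightarrow> (\<forall>t\<in>T. chart_polytope (z t) u \<subseteq> chart_polytope (z t) v))
       \<and> ((\<forall>t\<in>T. chart_polytope (z t) u \<subseteq> chart_polytope (z t) v)
            \<longleftrightarrow> u = v)"
proof -
  \<comment> \<open>The implications run in the cycle (a), (b), (d), (c), (a); the last one needs a
    chart to exist.\<close>
  have "T \<noteq> {}" using assms(1) by (simp add: positive_space_def)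
  moreover have "\<forall>\<beta>\<in>tropical_points T z. \<beta> u \<le> \<beta> v"
    if "\<exists>t\<in>T. chart_polytope (z t) u \<subseteq> chart_polytope (z t) v"
    using that tropical_le_of_chart_polytope_subset[OF assms] by blast
  moreover have "u = v" if "\<forall>\<beta>\<in>tropical_points T z. \<beta> u \<le> \<beta> v"
    using that global_monomial_eq_of_tropical_le[OF assms] by blast
  ultimately show ?thesis by blast
qed

end
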